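(* Let $(X,d)$ be an infinite metric space and let $\mathfrak{B}$ be a bornology on $X$ with a closed base such that $X\notin\mathfrak{B}$. The following statements are equivalent. (1) ONE has a predetermined winning strategy in $\mathcal{O}_{\mathfrak{B}^s}(X)$. (2) ONE has a predetermined winning strategy in $\Gamma_{\mathfrak{B}^s}(X)$. (3) TWO has a winning Markov strategy in $\mathsf{G}_1(\mathcal{O}_{\mathfrak{B}^s},\mathcal{O}_{\mathfrak{B}^s})$ on $X$. (4) TWO has a winning Markov strategy in $\mathsf{G}_1(\mathcal{O}_{\mathfrak{B}^s},\Gamma_{\mathfrak{B}^s})$ on $X$.
   Context: A bornology on a set $X$ is a family $\mathfrak{B}$ of subsets of $X$ that covers $X$, is closed under finite unions and is closed under taking subsets. A base of $\mathfrak{B}$ is a subfamily $\mathfrak{B}_0\subseteq\mathfrak{B}$ such that every $B\in\mathfrak{B}$ is contained in some $B_0\in\mathfrak{B}_0$; it is a closed base if all its members are closed in $X$. For $B\subseteq X$ and $\delta>0$, $B^\delta=\bigcup_{x\in B}\{y\in X: d(x,y)<\delta\}$. An open $\mathfrak{B}^s$-cover of $X$ is a family $\mathcal{U}$ of open subsets of $X$ that covers $X$ with $X\notin\mathcal{U}$ such that for every $B\in\mathfrak{B}$ there are $U\in\mathcal{U}$ and $\delta>0$ with $B^\delta\subseteq U$; $\mathcal{O}_{\mathfrak{B}^s}$ is the collection of all of them. A $\gamma_{\mathfrak{B}^s}$-cover of $X$ is an open cover $\{U_n:n\in\mathbb{N}\}$, infinite and not containing $X$ as a member, such that for every $B\in\mathfrak{B}$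 there are $n_0\in\mathbb{N}$ and positive reals $\delta_n$ ($n\ge n_0$) with $B^{\delta_n}\subseteq U_n$ for all $n\ge n_0$; $\Gamma_{\mathfrak{B}^s}$ is the collection of all of them. In the games $\mathcal{O}_{\mathfrak{B}^s}(X)$ and $\Gamma_{\mathfrak{B}^s}(X)$, in each round $n\in\mathbb{N}$ ONE chooses $B_n\in\mathfrak{B}$ and TWO responds with an open set $U_n\ne X$ such that $B_n^{\delta_n}\subseteq U_n$ for some $\delta_n>0$. In $\mathcal{O}_{\mathfrak{B}^s}(X)$ ONE wins if $\{U_n:n\in\mathbb{N}\}$ is an open $\mathfrak{B}^s$-cover of $X$; in $\Gamma_{\mathfrak{B}^s}(X)$ ONE wins if $\{U_n:n\in\mathbb{N}\}$ is a $\gamma_{\mathfrak{B}^s}$-cover of $X$. Otherwise TWO wins. In the game $\mathsf{G}_1(\mathcal{A},\mathcal{C})$, in each round $n$ ONE chooses $A_n\in\mathcal{A}$ and TWO responds with $b_n\in A_n$; TWO wins if $\{b_n:n\in\mathbb{N}\}\in\mathcal{C}$, otherwise ONE wins. A predetermined strategy for ONE is one depending only on the round number $n$. A Markov strategy for TWO in $\mathsf{G}_1(\mathcal{A},\mathcal{C})$ is a function $\sigma$ with $\sigma(A,n)\in A$ for all $A\in\mathcal{A}$, $n\in\mathbb{N}$ (TWO plays $\sigma(A_n,n)$ in round $n$). Such a strategy is winning if the player using it wins every play. *)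

theory Defs
  imports "HOL-Analysis.Analysis"
begin

text \<open>
  The metric space \<open>X\<close> is the universe of a type of class \<^class>\<open>metric_space\<close>; the assumption
  that \<open>X\<close> is infinite then reads \<open>infinite (UNIV :: 'a set)\<close>.
\<close>

definition bornology :: "'a set set \<Rightarrow> bool" where
  "bornology \<BB> \<longleftrightarrow>
     \<Union>\<BB> = UNIV \<and>
     (\<forall>\<F>. finite \<F> \<longrightarrow> \<F> \<subseteq> \<BB> \<longrightarrow> \<Union>\<F> \<in> \<BB>) \<and>
     (\<forall>B\<in>\<BB>. \<forall>A. A \<subseteq> B \<longrightarrow> A \<in> \<BB>)"

definition bornology_base :: "'a set set \<Rightarrow> 'a set set \<Rightarrow> bool" where
  "bornology_base \<BB>\<^sub>0 \<BB> \<longleftrightarrow> \<BB>\<^sub>0 \<subseteq> \<BB> \<and> (\<forall>B\<in>\<BB>. \<exists>B\<^sub>0\<in>\<BB>\<^sub>0. B \<subseteq> B\<^sub>0)"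

definition has_closed_base :: "'a::topological_space set set \<Rightarrow> bool" where
  "has_closed_base \<BB> \<longleftrightarrow> (\<exists>\<BB>\<^sub>0. bornology_base \<BB>\<^sub>0 \<BB> \<and> (\<forall>B\<in>\<BB>\<^sub>0. closed B))"

definition enlargement :: "'a::metric_space set \<Rightarrow> real \<Rightarrow> 'a set" where
  "enlargement B \<delta> = (\<Union>x\<in>B. {y. dist x y < \<delta>})"

definition open_cover :: "'a::topological_space set set \<Rightarrow> bool" where
  "open_cover \<U> \<longleftrightarrow> (\<forall>U\<in>\<U>. open U) \<and> \<Union>\<U> = UNIV"

definition open_Bs_covers :: "'a::metric_space set set \<Rightarrow> 'a set set set" where
  "open_Bs_covers \<BB> =
     {\<U>. open_cover \<U> \<and> UNIV \<notin> \<U> \<and>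
         (\<forall>B\<in>\<BB>. \<exists>U\<in>\<U>. \<exists>\<delta>>0. enlargement B \<delta> \<subseteq> U)}"

text \<open>
  A \<open>\<gamma>\<close>-cover is a family of sets, not a sequence: the enumeration \<open>U\<close> is existentially quantified
  and may repeat members. Hence, when the sets played in a game are tested for being a
  \<open>\<gamma>\<close>-cover, the witnessing enumeration need not be the order in which they were played.
\<close>

definition gamma_Bs_covers :: "'a::metric_space set set \<Rightarrow> 'a set set set" where
  "gamma_Bs_covers \<BB> =
     {\<U>. open_cover \<U> \<and> infinite \<U> \<and> UNIV \<notin> \<U> \<and>
         (\<exists>U :: nat \<Rightarrow> 'a set. \<U> = range U \<and>
            (\<forall>B\<in>\<BB>. \<exists>n\<^sub>0. \<exists>\<delta> :: nat \<Rightarrow> real.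
               \<forall>n\<ge>n\<^sub>0. \<delta> n > 0 \<and> enlargement B (\<delta> n) \<subseteq> U n))}"

text \<open>
  The games \<open>\<O>\<close> and \<open>\<Gamma>\<close> of \<open>\<BB>\<close> have the same moves and differ only in the collection \<open>\<W>\<close> of
  families with which ONE wins: \<open>open_Bs_covers \<BB>\<close> and \<open>gamma_Bs_covers \<BB>\<close>, respectively.
\<close>

definition legal_response :: "'a::metric_space set \<Rightarrow> 'a set \<Rightarrow> bool" where
  "legal_response B U \<longleftrightarrow> open U \<and> U \<noteq> UNIV \<and> (\<exists>\<delta>>0. enlargement B \<delta> \<subseteq> U)"

definition ONE_predetermined_winning ::
  "'a::metric_space set set \<Rightarrow> 'a set set set \<Rightarrow> (nat \<Rightarrow> 'a set) \<Rightarrow> bool" where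
  "ONE_predetermined_winning \<BB> \<W> \<sigma> \<longleftrightarrow>
     (\<forall>n. \<sigma> n \<in> \<BB>) \<and>
     (\<forall>U :: nat \<Rightarrow> 'a set. (\<forall>n. legal_response (\<sigma> n) (U n)) \<longrightarrow> range U \<in> \<W>)"

definition TWO_markov_winning_G1 ::
  "'b set set \<Rightarrow> 'b set set \<Rightarrow> ('b set \<Rightarrow> nat \<Rightarrow> 'b) \<Rightarrow> bool" where
  "TWO_markov_winning_G1 \<A> \<C> \<sigma> \<longleftrightarrow>
     (\<forall>A\<in>\<A>. \<forall>n. \<sigma> A n \<in> A) \<and>
     (\<forall>A :: nat \<Rightarrow> 'b set. (\<forall>n. A n \<in> \<A>) \<longrightarrow> range (\<lambda>n. \<sigma> (A n) n) \<in> \<C>)"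

end

(* The moves available to TWO against a fixed set B and the B^s-covers are dual to each other. If a
   Markov strategy of TWO is given, then in each round n some B in the bornology has the property
   that every legal response to B is chosen by the strategy from some cover: otherwise the responses
   never chosen would themselves form a cover. So ONE can play these sets and lets TWO's strategy win.
   Conversely, if ONE wins the first game by predetermined sets, then replacing them by closed
   supersets C n gives a countable base, because a point of B outside C n makes its complement a
   legal response that misses B. Finite unions turn this into an increasing base, against which every
   play is a gamma-cover. *)
theory Submission
  imports Defs
begin

lemma bornology_subset: "bornology \<BB> \<Longrightarrow> B \<in> \<BB> \<Longrightarrow> A \<subseteq> B \<Longrightarrow> A \<in> \<BB>"
  unfolding bornology_def by blast

lemma bornology_singleton:
  assumes "bornology \<BB>"
  shows "{x} \<in> \<BB>"
proof -
  have "x \<in> \<Union>\<BB>"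
    using assms by (simp add: bornology_def)
  then obtain B where "B \<in> \<BB>" "{x} \<subseteq> B"
    by blast
  then show ?thesis
    using assms bornology_subset by blast
qed

lemma bornology_finite_UN:
  assumes "bornology \<BB>" "finite I" "\<And>i. i \<in> I \<Longrightarrow> B i \<in> \<BB>"
  shows "(\<Union>i\<in>I. B i) \<in> \<BB>"
proof -
  have "finite (B ` I)" "B ` I \<subseteq> \<BB>"
    using assms by auto
  then show ?thesis
    using assms(1) unfolding bornology_def by blast
qed

lemma subset_enlargement: "\<delta> > 0 \<Longrightarrow> B \<subseteq> enlargement B \<delta>"
  by (auto simp: enlargement_def)

lemma enlargement_mono: "A \<subseteq> B \<Longrightarrow> enlargement A \<delta> \<subseteq> enlargement B \<delta>"
  by (auto simp: enlargement_def)

lemma legal_response_antimono: "legal_response B U \<Longrightarrow> A \<subseteq> B \<Longrightarrow> legal_response A U"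
  unfolding legal_response_def using enlargement_mono by blast

lemma legal_response_subset: "legal_response B U \<Longrightarrow> B \<subseteq> U"
  unfolding legal_response_def using subset_enlargement by blast

text \<open>Closedness gives a ball around \<open>x\<close> disjoint from \<open>B\<close>; by
  symmetry of the distance its radius is one for which the enlargement of \<open>B\<close> misses
  \<open>x\<close>. Thus TWO has a move that omits just one prescribed point.\<close>

lemma legal_response_Compl_singleton:
  assumes "closed B" "x \<notin> B"
  shows "legal_response B (- {x})"
proof -
  obtain e where e: "e > 0" "ball x e \<subseteq> - B"
    using assms by (meson ComplI open_Compl open_contains_ball)
  have "x \<notin> enlargement B e"
  proof
    assume "x \<in> enlargement B e"
    then obtain y where "y \<in> B" "dist y x < e"
      by (auto simp: enlargement_def)
    with e show False
      by (auto simp: dist_commute subset_iff)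
  qed
  with e show ?thesis
    by (auto simp: legal_response_def)
qed

text \<open>Singletons lie in a bornology, so a family with a legal response to every member
  automatically covers the space. In this form covers are the families of possible moves that meet
  every set of legal responses.\<close>

lemma open_Bs_covers_iff:
  assumes "bornology \<BB>"
  shows "\<U> \<in> open_Bs_covers \<BB> \<longleftrightarrow>
    (\<forall>U\<in>\<U>. open U \<and> U \<noteq> UNIV) \<and> (\<forall>B\<in>\<BB>. \<exists>U\<in>\<U>. legal_response B U)"
    (is "_ \<longleftrightarrow> ?R")
proof
  assume "\<U> \<in> open_Bs_covers \<BB>"
  then have U: "\<forall>U\<in>\<U>. open U \<and> U \<noteq> UNIV"
    and B: "\<forall>B\<in>\<BB>. \<exists>U\<in>\<U>. \<exists>\<delta>>0. enlargement B \<delta> \<subseteq> U"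
    by (auto simp: open_Bs_covers_def open_cover_def)
  then show ?R
    unfolding legal_response_def by meson
next
  assume R: ?R
  have "x \<in> \<Union>\<U>" for x
  proof -
    obtain U where "U \<in> \<U>" "legal_response {x} U"
      using R bornology_singleton[OF assms] by blast
    then show ?thesis
      using legal_response_subset by blast
  qed
  then have "\<Union>\<U> = UNIV"
    by blast
  moreover have "\<forall>B\<in>\<BB>. \<exists>U\<in>\<U>. \<exists>\<delta>>0. enlargement B \<delta> \<subseteq> U"
    using R unfolding legal_response_def by meson
  ultimately show "\<U> \<in> open_Bs_covers \<BB>"
    using R by (auto simp: open_Bs_covers_def open_cover_def)
qed

text \<open>The index \<open>n\<^sub>0\<close> alone already supplies a suitable member and radius
  for each \<open>B\<close>.\<close>

lemma gamma_Bs_covers_subset: "gamma_Bs_covers \<BB> \<subseteq> open_Bs_covers \<BB>"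
proof
  fix \<U> assume "\<U> \<in> gamma_Bs_covers \<BB>"
  then obtain U where *: "open_cover \<U>" "UNIV \<notin> \<U>" and U: "\<U> = range U"
    and B: "\<forall>B\<in>\<BB>. \<exists>n\<^sub>0. \<exists>\<delta> :: nat \<Rightarrow> real. \<forall>n\<ge>n\<^sub>0. \<delta> n > 0 \<and> enlargement B (\<delta> n) \<subseteq> U n"
    unfolding gamma_Bs_covers_def by blast
  have "\<exists>V\<in>\<U>. \<exists>\<delta>>0. enlargement B \<delta> \<subseteq> V" if "B \<in> \<BB>" for B
    using B that U by (meson order_refl rangeI)
  with * show "\<U> \<in> open_Bs_covers \<BB>"
    unfolding open_Bs_covers_def by blast
qed

lemma range_in_gamma_Bs_covers:
  assumes "bornology \<BB>" and "incseq D" and base: "\<And>B. B \<in> \<BB> \<Longrightarrow> \<exists>n. B \<subseteq> D n"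
    and legal: "\<And>n. legal_response (D n) (U n)"
  shows "range U \<in> gamma_Bs_covers \<BB>"
proof -
  \<comment> \<open>Once \<open>D n\<close> contains \<open>B\<close>, all later terms do, and a
    legal response to a set is legal to its subsets.\<close>
  have eventually_legal: "\<exists>n\<^sub>0. \<forall>n\<ge>n\<^sub>0. legal_response B (U n)" if "B \<in> \<BB>" for B
    using base[OF that] legal \<open>incseq D\<close>
    by (meson incseqD legal_response_antimono order_trans)
  have proper: "\<forall>n. open (U n) \<and> U n \<noteq> UNIV"
    using legal by (simp add: legal_response_def)
  have "\<exists>V\<in>range U. legal_response B V" if "B \<in> \<BB>" for B
    using eventually_legal[OF that] by blast
  then have "range U \<in> open_Bs_covers \<BB>"
    using proper by (auto simp: open_Bs_covers_iff[OF assms(1)])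
  then have "open_cover (range U)" "UNIV \<notin> range U"
    by (auto simp: open_Bs_covers_def)
  moreover have "infinite (range U)"
  proof
    assume "finite (range U)"
    \<comment> \<open>A value taken infinitely often would contain every point, since each singleton
      is eventually contained in \<open>U n\<close>; but no move is the whole space.\<close>
    then obtain k where k: "infinite {n. U n = U k}"
      using pigeonhole_infinite[of UNIV U] by auto
    have "x \<in> U k" for x
    proof -
      obtain n\<^sub>0 where n\<^sub>0: "\<And>n. n \<ge> n\<^sub>0 \<Longrightarrow> legal_response {x} (U n)"
        using eventually_legal bornology_singleton[OF assms(1)] by blast
      obtain n where "n \<ge> n\<^sub>0" "U n = U k"
        using k by (auto simp: infinite_nat_iff_unbounded_le)
      then show ?thesis
        using legal_response_subset[OF n\<^sub>0] by auto
    qed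
    with proper show False
      by blast
  qed
  moreover have "\<exists>n\<^sub>0. \<exists>\<delta> :: nat \<Rightarrow> real. \<forall>n\<ge>n\<^sub>0. \<delta> n > 0 \<and> enlargement B (\<delta> n) \<subseteq> U n"
    if "B \<in> \<BB>" for B
    using eventually_legal[OF that] unfolding legal_response_def by metis
  ultimately show ?thesis
    unfolding gamma_Bs_covers_def by blast
qed

lemma ONE_predetermined_winning_imp_incseq_base:
  assumes "bornology \<BB>" "has_closed_base \<BB>"
    and win: "ONE_predetermined_winning \<BB> (open_Bs_covers \<BB>) \<sigma>"
  obtains D where "incseq D" "\<And>n. D n \<in> \<BB>" "\<And>B. B \<in> \<BB> \<Longrightarrow> \<exists>n. B \<subseteq> D n"
proof -
  have "\<exists>C. C \<in> \<BB> \<and> closed C \<and> \<sigma> n \<subseteq> C" for n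
  proof -
    have "\<sigma> n \<in> \<BB>"
      using win by (simp add: ONE_predetermined_winning_def)
    then show ?thesis
      using \<open>has_closed_base \<BB>\<close> unfolding has_closed_base_def bornology_base_def by blast
  qed
  then obtain C where C: "\<And>n. C n \<in> \<BB>" "\<And>n. closed (C n)" "\<And>n. \<sigma> n \<subseteq> C n"
    by metis
  have base: "\<exists>n. B \<subseteq> C n" if "B \<in> \<BB>" for B
  proof (rule ccontr)
    assume "\<nexists>n. B \<subseteq> C n"
    then have "\<forall>n. \<exists>x. x \<in> B \<and> x \<notin> C n"
      by blast
    then obtain x where x: "\<And>n. x n \<in> B" "\<And>n. x n \<notin> C n"
      by metis
    \<comment> \<open>The complement of \<open>x n\<close> is legal against the closed set
      \<open>C n\<close>, hence against the smaller set \<open>\<sigma> n\<close> that ONE actually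
      plays.\<close>
    have "legal_response (\<sigma> n) (- {x n})" for n
      using legal_response_antimono[OF legal_response_Compl_singleton[OF C(2) x(2)] C(3)] .
    then have "range (\<lambda>n. - {x n}) \<in> open_Bs_covers \<BB>"
      using win by (simp add: ONE_predetermined_winning_def)
    then obtain n where "legal_response B (- {x n})"
      using \<open>B \<in> \<BB>\<close> unfolding open_Bs_covers_iff[OF assms(1)] by blast
    then show False
      using legal_response_subset x(1)[of n] by blast
  qed
  show thesis
  proof (rule that[of "\<lambda>n. \<Union>k\<le>n. C k"])
    show "incseq (\<lambda>n. \<Union>k\<le>n. C k)"
      by (intro monoI UN_mono) auto
    show "(\<Union>k\<le>n. C k) \<in> \<BB>" for n
      using bornology_finite_UN[OF assms(1)] C by blast
    show "\<exists>n. B \<subseteq> (\<Union>k\<le>n. C k)" if "B \<in> \<BB>" for B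
      using base[OF that] by blast
  qed
qed

text \<open>In round \<open>n\<close> TWO picks from the given cover a legal response to
  \<open>D n\<close>. This choice depends only on the cover and on \<open>n\<close>, and legality
  against the increasing base is enough for a gamma-cover, however the covers vary between
  rounds.\<close>

lemma incseq_base_imp_TWO_markov_winning:
  assumes "bornology \<BB>" "incseq D" "\<And>n. D n \<in> \<BB>" "\<And>B. B \<in> \<BB> \<Longrightarrow> \<exists>n. B \<subseteq> D n"
  obtains \<tau> where "TWO_markov_winning_G1 (open_Bs_covers \<BB>) (gamma_Bs_covers \<BB>) \<tau>"
proof -
  have "\<forall>\<U>\<in>open_Bs_covers \<BB>. \<forall>n. \<exists>U\<in>\<U>. legal_response (D n) U"
    using assms(3) by (simp add: open_Bs_covers_iff[OF assms(1)])
  then obtain \<tau> where \<tau>: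
    "\<And>\<U> n. \<U> \<in> open_Bs_covers \<BB> \<Longrightarrow> \<tau> \<U> n \<in> \<U> \<and> legal_response (D n) (\<tau> \<U> n)"
    by metis
  have "range (\<lambda>n. \<tau> (A n) n) \<in> gamma_Bs_covers \<BB>"
    if "\<forall>n. A n \<in> open_Bs_covers \<BB>" for A
    by (rule range_in_gamma_Bs_covers[OF assms(1,2)]) (use assms(4) \<tau> that in auto)
  then have "TWO_markov_winning_G1 (open_Bs_covers \<BB>) (gamma_Bs_covers \<BB>) \<tau>"
    unfolding TWO_markov_winning_G1_def using \<tau> by blast
  then show thesis
    by (rule that)
qed

text \<open>The argument never looks inside the winning collection; leaving \<open>\<W>\<close>
  arbitrary lets it serve both pairs of games.\<close>

lemma TWO_markov_winning_imp_ONE_predetermined_winning: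
  assumes "bornology \<BB>"
    and win: "TWO_markov_winning_G1 (open_Bs_covers \<BB>) \<W> \<tau>"
  obtains \<sigma> where "ONE_predetermined_winning \<BB> \<W> \<sigma>"
proof -
  have "\<exists>B\<in>\<BB>. \<forall>U. legal_response B U \<longrightarrow> (\<exists>\<U>\<in>open_Bs_covers \<BB>. \<tau> \<U> n = U)" for n
  proof (rule ccontr)
    assume "\<not> ?thesis"
    \<comment> \<open>\<open>V B\<close> is a legal response to \<open>B\<close> that
      \<open>\<tau>\<close> selects from no cover in round \<open>n\<close>. These sets together
      form a cover, from which \<open>\<tau>\<close> must nevertheless select one.\<close>
    then obtain V where V: "\<And>B. B \<in> \<BB> \<Longrightarrow> legal_response B (V B)"
      "\<And>B \<U>. B \<in> \<BB> \<Longrightarrow> \<U> \<in> open_Bs_covers \<BB> \<Longrightarrow> \<tau> \<U> n \<noteq> V B"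
      by metis
    have cover: "V ` \<BB> \<in> open_Bs_covers \<BB>"
      unfolding open_Bs_covers_iff[OF assms(1)]
    proof
      show "\<forall>U\<in>V ` \<BB>. open U \<and> U \<noteq> UNIV"
        using V(1) by (auto simp: legal_response_def)
      show "\<forall>B\<in>\<BB>. \<exists>U\<in>V ` \<BB>. legal_response B U"
        using V(1) by blast
    qed
    then have "\<tau> (V ` \<BB>) n \<in> V ` \<BB>"
      using win by (simp add: TWO_markov_winning_G1_def)
    with V(2)[OF _ cover] show False
      by blast
  qed
  then obtain \<sigma> where \<sigma>: "\<And>n. \<sigma> n \<in> \<BB>"
    "\<And>n U. legal_response (\<sigma> n) U \<Longrightarrow> \<exists>\<U>\<in>open_Bs_covers \<BB>. \<tau> \<U> n = U"
    by metis
  have "range U \<in> \<W>" if "\<forall>n. legal_response (\<sigma> n) (U n)" for U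
  proof -
    \<comment> \<open>Every play against \<open>\<sigma>\<close> is thereby reproduced as a play of
      the selection game in which \<open>\<tau>\<close> answers \<open>A n\<close> with exactly
      \<open>U n\<close>.\<close>
    have "\<forall>n. \<exists>\<U>. \<U> \<in> open_Bs_covers \<BB> \<and> \<tau> \<U> n = U n"
      using \<sigma>(2) that by blast
    then obtain A where A: "\<And>n. A n \<in> open_Bs_covers \<BB>" "\<And>n. \<tau> (A n) n = U n"
      by metis
    have "range (\<lambda>n. \<tau> (A n) n) \<in> \<W>"
      using win A(1) by (simp add: TWO_markov_winning_G1_def)
    then show ?thesis
      by (simp add: A(2))
  qed
  then have "ONE_predetermined_winning \<BB> \<W> \<sigma>"
    using \<sigma>(1) by (simp add: ONE_predetermined_winning_def)
  then show thesis
    by (rule that)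
qed

theorem theorem5p3:
  fixes \<BB> :: "'a::metric_space set set"
  assumes "infinite (UNIV :: 'a set)"
    and "bornology \<BB>"
    and "has_closed_base \<BB>"
    and "UNIV \<notin> \<BB>"
  defines "S1 \<equiv> \<exists>\<sigma>. ONE_predetermined_winning \<BB> (open_Bs_covers \<BB>) \<sigma>"
    and "S2 \<equiv> \<exists>\<sigma>. ONE_predetermined_winning \<BB> (gamma_Bs_covers \<BB>) \<sigma>"
    and "S3 \<equiv> \<exists>\<sigma>. TWO_markov_winning_G1 (open_Bs_covers \<BB>) (open_Bs_covers \<BB>) \<sigma>"
    and "S4 \<equiv> \<exists>\<sigma>. TWO_markov_winning_G1 (open_Bs_covers \<BB>) (gamma_Bs_covers \<BB>) \<sigma>"
  shows "(S1 \<longleftrightarrow> S2) \<and> (S2 \<longleftrightarrow> S3) \<and> (S3 \<longleftrightarrow> S4)"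
proof -
  \<comment> \<open>The cycle from \<open>S1\<close> to \<open>S4\<close> to \<open>S2\<close> and
    back to \<open>S1\<close>, with the detour from \<open>S4\<close> through \<open>S3\<close> to
    \<open>S1\<close>, yields all the equivalences.\<close>
  have "S4" if S1: "S1"
  proof -
    obtain \<sigma> where "ONE_predetermined_winning \<BB> (open_Bs_covers \<BB>) \<sigma>"
      using S1 unfolding S1_def by blast
    then obtain D where "incseq D" "\<And>n. D n \<in> \<BB>" "\<And>B. B \<in> \<BB> \<Longrightarrow> \<exists>n. B \<subseteq> D n"
      using ONE_predetermined_winning_imp_incseq_base[OF assms(2,3)] by metis
    then show ?thesis
      unfolding S4_def using incseq_base_imp_TWO_markov_winning[OF assms(2), of D] by blast
  qed
  moreover have "S2" if "S4"
    using that TWO_markov_winning_imp_ONE_predetermined_winning[OF assms(2)]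
    unfolding S2_def S4_def by blast
  moreover have "S1" if "S3"
    using that TWO_markov_winning_imp_ONE_predetermined_winning[OF assms(2)]
    unfolding S1_def S3_def by blast
  moreover have "S1" if "S2"
    using that gamma_Bs_covers_subset[of \<BB>]
    unfolding S1_def S2_def ONE_predetermined_winning_def by blast
  moreover have "S3" if "S4"
    using that gamma_Bs_covers_subset[of \<BB>]
    unfolding S3_def S4_def TWO_markov_winning_G1_def by blast
  ultimately show ?thesis
    by blast
qed

end
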